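(* Let $m\ge 2$ and $N\ge 1$ be integers. For each $i\in\{1,\dots,m\}$ let $X_i\subseteq\mathbb{R}^N$ be a Lipschitz sub-manifold of dimension $d_i$, and let $\mu_i$ be a probability measure on $X_i$ with compact support in $X_i$. Let $\mathbf{X}=X_1\times\cdots\times X_m$ and let $c:\mathbf{X}\to\mathbb{R}_+$ be a locally Lipschitz function. Then, as $\varepsilon\to0^+$, $$\mathsf{MOT}_\varepsilon\le \mathsf{MOT}_0+\Bigl(\sum_{i=1}^m d_i-\max_{1\le j\le m}d_j\Bigr)\,\varepsilon\log(1/\varepsilon)+O(\varepsilon).$$
   Context: $\Pi(\mu_1,\dots,\mu_m)$ denotes the set of Borel probability measures $\gamma$ on $\mathbf{X}=X_1\times\cdots\times X_m$ whose $i$-th marginal is $\mu_i$ for every $i\in\{1,\dots,m\}$. For probability measures $p,q$, the Boltzmann–Shannon relative entropy is $\mathrm{Ent}(p\,|\,q)=\int\rho\log\rho\,\mathrm{d}q$ if $p=\rho q$ (i.e. $p$ is absolutely continuous with respect to $q$ with density $\rho$), and $\mathrm{Ent}(p\,|\,q)=+\infty$ otherwise. For $\varepsilon>0$, $$\mathsf{MOT}_\varepsilon=\inf\Bigl\{\int_{\mathbf{X}}c\,\mathrm{d}\gamma+\varepsilon\,\mathrm{Ent}\bigl(\gamma\,|\,\otimes_{i=1}^m\mu_i\bigr)\;:\;\gamma\in\Pi(\mu_1,\dots,\mu_m)\Bigr\},$$ and $$\mathsf{MOT}_0=\inf\Bigl\{\int_{\mathbf{X}}c\,\mathrm{d}\gamma\;:\;\gamma\in\Pi(\mu_1,\dots,\mu_m)\Bigr\}.$$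 Distances are Euclidean on $\mathbb{R}^N$, and the product $(\mathbb{R}^N)^m$ carries the norm $\|\mathbf{x}\|=\max_i|x_i|$. A Lipschitz sub-manifold of dimension $d$ is a subset of $\mathbb{R}^N$ each of whose points has a relatively open neighbourhood that is bi-Lipschitz homeomorphic to an open subset of $\mathbb{R}^d$. *)

theory Defs
  imports "HOL-Probability.Probability" "HOL-Library.Landau_Symbols"
begin

text \<open>
  The index set $\{1,\dots,m\}$ is a finite type \<open>'m\<close>, the space $\mathbb{R}^N$ is \<open>real ^ 'n\<close>,
  and points of $(\mathbb{R}^N)^m$ are functions \<open>'m \<Rightarrow> real ^ 'n\<close>. The library instance
  of \<open>dist\<close> on function types is a weighted series rather than the maximum, so the maximum
  distance is introduced separately.
\<close>

definition max_dist :: "('m::finite \<Rightarrow> real ^ 'n) \<Rightarrow> ('m \<Rightarrow> real ^ 'n) \<Rightarrow> real"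
  where "max_dist x y = Max (range (\<lambda>i. dist (x i) (y i)))"

definition locally_lipschitz_on ::
    "('m::finite \<Rightarrow> real ^ 'n) set \<Rightarrow> (('m \<Rightarrow> real ^ 'n) \<Rightarrow> real) \<Rightarrow> bool"
  where "locally_lipschitz_on S f \<longleftrightarrow>
    (\<forall>x\<in>S. \<exists>r>0. \<exists>L. \<forall>y\<in>S. \<forall>z\<in>S.
       max_dist x y < r \<longrightarrow> max_dist x z < r \<longrightarrow> \<bar>f y - f z\<bar> \<le> L * max_dist y z)"

text \<open>
  The dimension of a manifold is an arbitrary natural number, so charts take values in the
  library's \<open>Euclidean_space d\<close>: real sequences vanishing from index \<open>d\<close> on, with the
  product topology, on which \<open>L2_set (\<lambda>k. u k - v k) {..<d}\<close> is the Euclidean distance.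
  The two inequalities make the chart injective, so it is a bi-Lipschitz bijection
  from \<open>V\<close> onto its image.
\<close>

definition lipschitz_submanifold :: "nat \<Rightarrow> (real ^ 'n) set \<Rightarrow> bool"
  where "lipschitz_submanifold d S \<longleftrightarrow>
    (\<forall>p\<in>S. \<exists>V \<phi> L. p \<in> V \<and> openin (top_of_set S) V \<and>
       openin (Euclidean_space d) (\<phi> ` V) \<and> 0 < L \<and>
       (\<forall>x\<in>V. \<forall>y\<in>V.
          dist x y / L \<le> L2_set (\<lambda>k. \<phi> x k - \<phi> y k) {..<d} \<and>
          L2_set (\<lambda>k. \<phi> x k - \<phi> y k) {..<d} \<le> L * dist x y))"

text \<open>The support is taken relative to the space on which the measure lives.\<close>

definition measure_support :: "'a::topological_space measure \<Rightarrow> 'a set"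
  where "measure_support M =
    {x \<in> space M. \<forall>U. open U \<longrightarrow> x \<in> U \<longrightarrow> 0 < emeasure M (U \<inter> space M)}"

text \<open>
  The library's \<open>borel\<close> on \<open>'m \<Rightarrow> real ^ 'n\<close> is generated by the product topology.
\<close>

definition couplings ::
    "('m::finite \<Rightarrow> (real ^ 'n) measure) \<Rightarrow> ('m \<Rightarrow> real ^ 'n) measure set"
  where "couplings \<mu> =
    {\<gamma>. prob_space \<gamma> \<and>
        sets \<gamma> = sets (restrict_space borel (\<Pi>\<^sub>E i\<in>UNIV. space (\<mu> i))) \<and>
        (\<forall>i. distr \<gamma> (\<mu> i) (\<lambda>x. x i) = \<mu> i)}"

text \<open>
  Integral with values in the extended reals, for functions whose positive or negative part
  has finite integral; the Bochner integral would give \<open>0\<close> instead of \<open>\<infinity>\<close>.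
\<close>

definition ext_integral :: "'a measure \<Rightarrow> ('a \<Rightarrow> real) \<Rightarrow> ereal"
  where "ext_integral M f =
    enn2ereal (\<integral>\<^sup>+x. ennreal (f x) \<partial>M) - enn2ereal (\<integral>\<^sup>+x. ennreal (- f x) \<partial>M)"

text \<open>
  \<open>RN_deriv q p\<close> is a density of \<open>p\<close> with respect to \<open>q\<close> whenever one exists. For probability
  measures the negative part of $\rho\log\rho$ has finite integral, and \<open>0 * ln 0 = 0\<close>.
\<close>

definition rel_entropy :: "'a measure \<Rightarrow> 'a measure \<Rightarrow> ereal"
  where "rel_entropy p q =
    (if \<exists>\<rho>\<in>borel_measurable q. p = density q \<rho>
     then ext_integral q (\<lambda>x. enn2real (RN_deriv q p x) * ln (enn2real (RN_deriv q p x)))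
     else \<infinity>)"

definition MOT_reg ::
    "('m::finite \<Rightarrow> (real ^ 'n) measure) \<Rightarrow> (('m \<Rightarrow> real ^ 'n) \<Rightarrow> real) \<Rightarrow> real \<Rightarrow> ereal"
  where "MOT_reg \<mu> c \<epsilon> =
    (INF \<gamma>\<in>couplings \<mu>. ext_integral \<gamma> c + ereal \<epsilon> * rel_entropy \<gamma> (PiM UNIV \<mu>))"

definition MOT_zero ::
    "('m::finite \<Rightarrow> (real ^ 'n) measure) \<Rightarrow> (('m \<Rightarrow> real ^ 'n) \<Rightarrow> real) \<Rightarrow> ereal"
  where "MOT_zero \<mu> c = (INF \<gamma>\<in>couplings \<mu>. ext_integral \<gamma> c)"

end

theory Submission
  imports Defs
begin

text \<open>
  The upper bound comes from replacing a coupling \<open>\<gamma>\<close> by its block approximation at scale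
  \<open>\<epsilon>\<close>. Since a bi-Lipschitz chart transports a grid of mesh comparable to \<open>\<epsilon>\<close>, the compact
  support of \<open>\<mu> i\<close> is a disjoint union of \<open>n i\<close> Borel cells of diameter at most \<open>2 * \<epsilon>\<close>, where
  \<open>n i \<le> C i * (1 / \<epsilon>) ^ d i\<close> with \<open>C i\<close> independent of \<open>\<epsilon>\<close> (\<open>has_nets_of_order_submanifold\<close>,
  \<open>borel_partition_of_nets\<close>). Their products are cells \<open>Q\<close> of the product space. On each \<open>Q\<close>
  the measure \<open>\<gamma>\<close> is replaced by the multiple of the product measure \<open>\<Otimes> \<mu> i\<close> that gives \<open>Q\<close> the
  mass \<open>\<gamma> Q\<close>. The result is again a coupling (\<open>marginal_block\<close>).

  The cost changes by at most the oscillation of \<open>c\<close> on a cell (\<open>ext_integral_block_le\<close>), which is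
  \<open>O(\<epsilon>)\<close>: a locally Lipschitz function is Lipschitz at small distances on a compact set
  (\<open>locally_lipschitz_on_compact\<close>). The entropy of the new coupling is the finite sum of
  \<open>\<gamma> Q * ln (\<gamma> Q / (\<Prod>i. \<mu> i (Q i)))\<close>. For any index \<open>j\<close> one has \<open>\<gamma> Q \<le> \<mu> j (Q j)\<close>, so the factor \<open>j\<close>
  drops out and the entropy is at most the sum over \<open>i \<noteq> j\<close> of the Shannon entropies of the
  partitions, hence at most the sum of \<open>ln (n i)\<close> over \<open>i \<noteq> j\<close> (\<open>rel_entropy_block_le\<close>). This is at
  most \<open>(\<Sum>i\<noteq>j. d i) * ln (1 / \<epsilon>)\<close> up to a constant, and the best choice of \<open>j\<close> is an index of
  maximal dimension. All bounds are uniform in \<open>\<gamma>\<close>, so the infimum over \<open>\<gamma>\<close> gives the theorem.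
\<close>

section \<open>Covering numbers of compact subsets of Lipschitz submanifolds\<close>

text \<open>
  The covering numbers of \<open>S\<close> at scale \<open>\<epsilon> \<le> 1\<close> are \<open>O((1 / \<epsilon>) ^ d)\<close>, with centres taken in \<open>S\<close>.
  Asking for \<open>C \<ge> 1\<close> is harmless and makes \<open>ln C\<close> meaningful.
\<close>

definition has_nets_of_order :: "nat \<Rightarrow> 'a::metric_space set \<Rightarrow> bool"
  where "has_nets_of_order d S \<longleftrightarrow>
    (\<exists>C\<ge>1. \<forall>\<epsilon>. 0 < \<epsilon> \<longrightarrow> \<epsilon> \<le> 1 \<longrightarrow>
       (\<exists>F. finite F \<and> F \<subseteq> S \<and> real (card F) \<le> C * (1 / \<epsilon>) ^ d \<and> S \<subseteq> (\<Union>x\<in>F. cball x \<epsilon>)))"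

lemma has_nets_of_order_empty: "has_nets_of_order d {}"
  unfolding has_nets_of_order_def by (intro exI[of _ 1]) auto

lemma has_nets_of_order_Un:
  assumes "has_nets_of_order d S" "has_nets_of_order d T"
  shows "has_nets_of_order d (S \<union> T)"
proof -
  obtain C where C: "C \<ge> 1" and hC: "\<And>\<epsilon>::real. 0 < \<epsilon> \<Longrightarrow> \<epsilon> \<le> 1 \<Longrightarrow>
       \<exists>F. finite F \<and> F \<subseteq> S \<and> real (card F) \<le> C * (1 / \<epsilon>) ^ d \<and> S \<subseteq> (\<Union>x\<in>F. cball x \<epsilon>)"
    using assms(1) unfolding has_nets_of_order_def by blast
  obtain D where D: "D \<ge> 1" and hD: "\<And>\<epsilon>::real. 0 < \<epsilon> \<Longrightarrow> \<epsilon> \<le> 1 \<Longrightarrow>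
       \<exists>F. finite F \<and> F \<subseteq> T \<and> real (card F) \<le> D * (1 / \<epsilon>) ^ d \<and> T \<subseteq> (\<Union>x\<in>F. cball x \<epsilon>)"
    using assms(2) unfolding has_nets_of_order_def by blast
  show ?thesis
    unfolding has_nets_of_order_def
  proof (intro exI[of _ "C + D"] conjI allI impI)
    show "1 \<le> C + D" using C D by simp
    fix \<epsilon> :: real assume e: "0 < \<epsilon>" "\<epsilon> \<le> 1"
    obtain F where F: "finite F" "F \<subseteq> S" "real (card F) \<le> C * (1 / \<epsilon>) ^ d"
        "S \<subseteq> (\<Union>x\<in>F. cball x \<epsilon>)" using hC[OF e] by blast
    obtain G where G: "finite G" "G \<subseteq> T" "real (card G) \<le> D * (1 / \<epsilon>) ^ d"
        "T \<subseteq> (\<Union>x\<in>G. cball x \<epsilon>)" using hD[OF e] by blast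
    have "real (card (F \<union> G)) \<le> real (card F) + real (card G)"
      by (metis card_Un_le of_nat_add of_nat_le_iff)
    then have "real (card (F \<union> G)) \<le> (C + D) * (1 / \<epsilon>) ^ d"
      using F(3) G(3) by (simp add: distrib_right)
    moreover have "S \<union> T \<subseteq> (\<Union>x\<in>F \<union> G. cball x \<epsilon>)"
      using F(4) G(4) unfolding UN_Un by (rule Un_mono)
    ultimately show "\<exists>H. finite H \<and> H \<subseteq> S \<union> T \<and> real (card H) \<le> (C + D) * (1 / \<epsilon>) ^ d
        \<and> S \<union> T \<subseteq> (\<Union>x\<in>H. cball x \<epsilon>)"
      using F(1,2) G(1,2) by (intro exI[of _ "F \<union> G"]) blast
  qed
qed

text \<open>
  A bounded family of \<open>d\<close> coordinates controlling the distance from above is enough: points whose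
  coordinates lie in the same cube of a fine grid are close. No surjectivity is needed.
\<close>

lemma has_nets_of_order_coordinates:
  fixes \<phi> :: "'a::metric_space \<Rightarrow> nat \<Rightarrow> real"
  assumes L: "0 \<le> L" and B: "0 \<le> B"
    and dist: "\<And>x y. x \<in> S \<Longrightarrow> y \<in> S \<Longrightarrow> dist x y \<le> L * (\<Sum>k<d. \<bar>\<phi> x k - \<phi> y k\<bar>)"
    and bound: "\<And>x k. x \<in> S \<Longrightarrow> k < d \<Longrightarrow> \<bar>\<phi> x k\<bar> \<le> B"
  shows "has_nets_of_order d S"
proof -
  define A where "A = 2 * B * (L * d + 1) + 2"
  have A: "A \<ge> 1" using L B by (simp add: A_def)
  show ?thesis
    unfolding has_nets_of_order_def
  proof (intro exI[of _ "A ^ d"] conjI allI impI)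
    show "1 \<le> A ^ d" using A by simp
    fix \<epsilon> :: real assume e: "0 < \<epsilon>" "\<epsilon> \<le> 1"
    define \<eta> where "\<eta> = \<epsilon> / (L * d + 1)"
    have Ld: "0 \<le> L * d" using L by simp
    have \<eta>: "0 < \<eta>" using e Ld unfolding \<eta>_def by (intro divide_pos_pos) auto
    define g where "g x = (\<lambda>k\<in>{..<d}. \<lfloor>\<phi> x k / \<eta>\<rfloor>)" for x
    define J where "J = {\<lfloor>- B / \<eta>\<rfloor>..\<lfloor>B / \<eta>\<rfloor>}"
    have gS: "g ` S \<subseteq> {..<d} \<rightarrow>\<^sub>E J"
    proof -
      have "\<lfloor>\<phi> x k / \<eta>\<rfloor> \<in> J" if "x \<in> S" "k < d" for x k
      proof -
        have "- B \<le> \<phi> x k" "\<phi> x k \<le> B" using bound[OF that] by auto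
        then have "- B / \<eta> \<le> \<phi> x k / \<eta>" "\<phi> x k / \<eta> \<le> B / \<eta>"
          using \<eta> by (auto intro: divide_right_mono simp del: divide_minus_left)
        then show ?thesis unfolding J_def by (simp add: floor_mono)
      qed
      then show ?thesis unfolding g_def by (auto intro!: restrict_PiE_iff[THEN iffD2])
    qed
    have "real (card J) \<le> 2 * B / \<eta> + 2"
    proof -
      have "0 \<le> B / \<eta>" using B \<eta> by simp
      then have "\<lfloor>- B / \<eta>\<rfloor> \<le> \<lfloor>B / \<eta>\<rfloor>" by (intro floor_mono) simp
      then have "real (card J) = of_int \<lfloor>B / \<eta>\<rfloor> - of_int \<lfloor>- B / \<eta>\<rfloor> + 1"
        by (simp add: J_def)
      also have "\<dots> \<le> B / \<eta> - (- B / \<eta> - 1) + 1" by linarith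
      finally show ?thesis by simp
    qed
    also have "\<dots> = (2 * B * (L * d + 1) + 2 * \<epsilon>) / \<epsilon>"
      using e Ld by (simp add: \<eta>_def field_simps)
    also have "\<dots> \<le> A * (1 / \<epsilon>)"
      using e by (simp add: A_def divide_right_mono)
    finally have J: "real (card J) \<le> A * (1 / \<epsilon>)" .
    have fin: "finite ({..<d} \<rightarrow>\<^sub>E J)" by (intro finite_PiE) (auto simp: J_def)
    \<comment> \<open>One point of \<open>S\<close> for each grid cube that meets the coordinate image of \<open>S\<close>.\<close>
    define F where "F = inv_into S g ` g ` S"
    have "finite F" unfolding F_def using finite_subset[OF gS fin] by blast
    moreover have "F \<subseteq> S" unfolding F_def by (auto intro: inv_into_into)
    moreover have "real (card F) \<le> A ^ d * (1 / \<epsilon>) ^ d"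
    proof -
      have "card F \<le> card (g ` S)" unfolding F_def
        using finite_subset[OF gS fin] by (rule card_image_le)
      also have "\<dots> \<le> card ({..<d} \<rightarrow>\<^sub>E J)" by (rule card_mono[OF fin gS])
      also have "\<dots> = card J ^ d" by (simp add: card_funcsetE)
      finally have "real (card F) \<le> real (card J) ^ d" by (metis of_nat_le_iff of_nat_power)
      also have "\<dots> \<le> (A * (1 / \<epsilon>)) ^ d" using J by (intro power_mono) auto
      finally show ?thesis by (simp add: power_mult_distrib power_divide)
    qed
    moreover have "S \<subseteq> (\<Union>x\<in>F. cball x \<epsilon>)"
    proof
      fix x assume x: "x \<in> S"
      define y where "y = inv_into S g (g x)"
      have y: "y \<in> S" "g y = g x"
        using x unfolding y_def by (auto intro: inv_into_into f_inv_into_f)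
      have "\<bar>\<phi> y k - \<phi> x k\<bar> \<le> \<eta>" if "k < d" for k
      proof -
        have "\<lfloor>\<phi> y k / \<eta>\<rfloor> = \<lfloor>\<phi> x k / \<eta>\<rfloor>"
          using fun_cong[OF y(2), of k] that by (simp add: g_def)
        then have "\<bar>\<phi> y k / \<eta> - \<phi> x k / \<eta>\<bar> \<le> 1" by linarith
        then have "\<bar>(\<phi> y k - \<phi> x k) / \<eta>\<bar> \<le> 1" by (simp add: diff_divide_distrib)
        then show ?thesis using \<eta> by (simp add: abs_divide)
      qed
      then have "(\<Sum>k<d. \<bar>\<phi> y k - \<phi> x k\<bar>) \<le> (\<Sum>k<d. \<eta>)" by (intro sum_mono) auto
      then have "L * (\<Sum>k<d. \<bar>\<phi> y k - \<phi> x k\<bar>) \<le> L * (d * \<eta>)"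
        using L by (intro mult_left_mono) auto
      with dist[OF y(1) x] have "dist y x \<le> L * d * \<eta>" by simp
      also have "\<dots> \<le> (L * d + 1) * \<eta>" using \<eta> by (intro mult_right_mono) auto
      also have "\<dots> = \<epsilon>" using Ld by (simp add: \<eta>_def)
      finally show "x \<in> (\<Union>x\<in>F. cball x \<epsilon>)" using x unfolding F_def y_def by auto
    qed
    ultimately show "\<exists>F. finite F \<and> F \<subseteq> S \<and> real (card F) \<le> A ^ d * (1 / \<epsilon>) ^ d
        \<and> S \<subseteq> (\<Union>x\<in>F. cball x \<epsilon>)" by blast
  qed
qed

text \<open>On compact sets the covering bound is a local property.\<close>

lemma has_nets_of_order_compact_local:
  assumes K: "compact K" and local: "\<And>p. p \<in> K \<Longrightarrow> \<exists>U. open U \<and> p \<in> U \<and> has_nets_of_order d (K \<inter> U)"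
  shows "has_nets_of_order d K"
proof -
  have cover: "K \<subseteq> \<Union>{U. open U \<and> has_nets_of_order d (K \<inter> U)}" using local by blast
  obtain \<U> where \<U>: "\<U> \<subseteq> {U. open U \<and> has_nets_of_order d (K \<inter> U)}" "finite \<U>" "K \<subseteq> \<Union>\<U>"
    by (rule compactE[OF K cover]) simp
  have "has_nets_of_order d (\<Union>U\<in>\<V>. K \<inter> U)" if "finite \<V>" "\<V> \<subseteq> \<U>" for \<V>
    using that
  proof (induction \<V>)
    case empty
    show ?case by (simp add: has_nets_of_order_empty)
  next
    case (insert U \<V>)
    have "has_nets_of_order d (K \<inter> U)" using insert.prems \<U>(1) by auto
    moreover have "has_nets_of_order d (\<Union>U\<in>\<V>. K \<inter> U)" using insert by simp
    ultimately show ?case by (simp add: has_nets_of_order_Un)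
  qed
  from this[OF \<U>(2) subset_refl] have "has_nets_of_order d (\<Union>U\<in>\<U>. K \<inter> U)" .
  moreover have "(\<Union>U\<in>\<U>. K \<inter> U) = K" using \<U>(3) by blast
  ultimately show ?thesis by simp
qed

lemma has_nets_of_order_near_point:
  assumes X: "lipschitz_submanifold d X" and K: "K \<subseteq> X" and p: "p \<in> K"
  shows "\<exists>U. open U \<and> p \<in> U \<and> has_nets_of_order d (K \<inter> U)"
proof -
  have "p \<in> X" using p K by blast
  then obtain V \<phi> L where chart: "p \<in> V \<and> openin (top_of_set X) V \<and>
     openin (Euclidean_space d) (\<phi> ` V) \<and> 0 < L \<and>
     (\<forall>x\<in>V. \<forall>y\<in>V.
        dist x y / L \<le> L2_set (\<lambda>k. \<phi> x k - \<phi> y k) {..<d} \<and>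
        L2_set (\<lambda>k. \<phi> x k - \<phi> y k) {..<d} \<le> L * dist x y)"
    using X[unfolded lipschitz_submanifold_def] by (elim ballE exE) (rule that, assumption, simp)
  have V: "p \<in> V" "openin (top_of_set X) V" and L: "0 < L" using chart by simp_all
  have bi: "dist x y / L \<le> L2_set (\<lambda>k. \<phi> x k - \<phi> y k) {..<d} \<and>
      L2_set (\<lambda>k. \<phi> x k - \<phi> y k) {..<d} \<le> L * dist x y" if "x \<in> V" "y \<in> V" for x y
    using chart that by simp
  obtain T where T: "open T" "V = X \<inter> T" using V(2) by (auto simp: openin_open)
  have sub: "K \<inter> (T \<inter> ball p 1) \<subseteq> V" using K T(2) by blast
  \<comment> \<open>On the unit ball around \<open>p\<close> the chart is bounded by its upper Lipschitz estimate.\<close>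
  have "has_nets_of_order d (K \<inter> (T \<inter> ball p 1))"
  proof (rule has_nets_of_order_coordinates)
    show "0 \<le> L" using L by simp
    show "0 \<le> (\<Sum>k<d. \<bar>\<phi> p k\<bar>) + L" using L by (intro add_nonneg_nonneg sum_nonneg) auto
  next
    fix x y assume xy: "x \<in> K \<inter> (T \<inter> ball p 1)" "y \<in> K \<inter> (T \<inter> ball p 1)"
    then have "dist x y / L \<le> L2_set (\<lambda>k. \<phi> x k - \<phi> y k) {..<d}" using bi sub by blast
    also have "\<dots> \<le> (\<Sum>k<d. \<bar>\<phi> x k - \<phi> y k\<bar>)" by (rule L2_set_le_sum_abs)
    finally show "dist x y \<le> L * (\<Sum>k<d. \<bar>\<phi> x k - \<phi> y k\<bar>)"
      using L by (simp add: field_simps)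
  next
    fix x k assume x: "x \<in> K \<inter> (T \<inter> ball p 1)" and k: "k < d"
    have "\<bar>\<phi> x k - \<phi> p k\<bar> \<le> L2_set (\<lambda>k. \<bar>\<phi> x k - \<phi> p k\<bar>) {..<d}"
      using k by (intro member_le_L2_set) auto
    also have "\<dots> = L2_set (\<lambda>k. \<phi> x k - \<phi> p k) {..<d}" by (simp add: L2_set_def)
    also have "\<dots> \<le> L * dist x p" using bi[of x p] x sub V(1) by blast
    also have "\<dots> \<le> L * 1" using x L by (intro mult_left_mono) (auto simp: dist_commute)
    finally have "\<bar>\<phi> x k - \<phi> p k\<bar> \<le> L" by simp
    moreover have "\<bar>\<phi> p k\<bar> \<le> (\<Sum>k<d. \<bar>\<phi> p k\<bar>)" using k by (intro member_le_sum) auto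
    ultimately show "\<bar>\<phi> x k\<bar> \<le> (\<Sum>k<d. \<bar>\<phi> p k\<bar>) + L" by linarith
  qed
  moreover have "open (T \<inter> ball p 1)" "p \<in> T \<inter> ball p 1" using T V(1) by auto
  ultimately show ?thesis by blast
qed

lemma has_nets_of_order_submanifold:
  assumes X: "lipschitz_submanifold d X" and K: "compact K" "K \<subseteq> X"
  shows "has_nets_of_order d K"
  using K(1) has_nets_of_order_near_point[OF X K(2)] by (rule has_nets_of_order_compact_local)

lemma borel_partition_of_nets:
  fixes K :: "'a::metric_space set"
  assumes nets: "has_nets_of_order d K" and K: "closed K" "K \<noteq> {}"
  obtains C where "C \<ge> 1" and "\<And>\<epsilon>::real. 0 < \<epsilon> \<Longrightarrow> \<epsilon> \<le> 1 \<Longrightarrow>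
    \<exists>n Q. 0 < n \<and> real n \<le> C * (1 / \<epsilon>) ^ d \<and> disjoint_family_on Q {..<n} \<and> (\<Union>k<n. Q k) = K \<and>
      (\<forall>k<n. Q k \<in> sets borel \<and> (\<forall>x\<in>Q k. \<forall>y\<in>Q k. dist x y \<le> 2 * \<epsilon>))"
proof -
  obtain C where C: "C \<ge> 1" and hC: "\<And>\<epsilon>::real. 0 < \<epsilon> \<Longrightarrow> \<epsilon> \<le> 1 \<Longrightarrow>
       \<exists>F. finite F \<and> F \<subseteq> K \<and> real (card F) \<le> C * (1 / \<epsilon>) ^ d \<and> K \<subseteq> (\<Union>x\<in>F. cball x \<epsilon>)"
    using nets unfolding has_nets_of_order_def by blast
  show thesis
  proof (rule that[OF C])
    fix \<epsilon> :: real assume e: "0 < \<epsilon>" "\<epsilon> \<le> 1"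
    obtain F where F: "finite F" "F \<subseteq> K" "real (card F) \<le> C * (1 / \<epsilon>) ^ d"
        "K \<subseteq> (\<Union>x\<in>F. cball x \<epsilon>)" using hC[OF e] by blast
    define n where "n = card F"
    obtain f where f: "bij_betw f {..<n} F"
      using ex_bij_betw_nat_finite[OF F(1)] unfolding n_def lessThan_atLeast0 by blast
    define Q where "Q = disjointed (\<lambda>k. K \<inter> cball (f k) \<epsilon>)"
    have Fne: "F \<noteq> {}" using F(4) K(2) by auto
    have sub: "Q k \<subseteq> K \<inter> cball (f k) \<epsilon>" for k unfolding Q_def by (rule disjointed_subset)
    have n: "0 < n" using F(1) Fne by (simp add: n_def card_gt_0_iff)
    have un: "(\<Union>k<n. Q k) = K"
    proof -
      have "(\<Union>k<n. Q k) = (\<Union>k<n. K \<inter> cball (f k) \<epsilon>)"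
        unfolding Q_def lessThan_atLeast0 by (rule finite_UN_disjointed_eq)
      also have "\<dots> = (\<Union>x\<in>F. K \<inter> cball x \<epsilon>)"
        unfolding bij_betw_imp_surj_on[OF f, symmetric] by (simp only: image_image)
      also have "\<dots> = K" using F(4) by blast
      finally show ?thesis .
    qed
    have meas: "Q k \<in> sets borel" for k
    proof -
      have "range Q \<subseteq> sets borel" unfolding Q_def
        using K(1) by (intro sets.range_disjointed_sets) (auto intro!: borel_closed)
      then show ?thesis by blast
    qed
    have disj: "disjoint_family_on Q {..<n}"
      unfolding Q_def using disjoint_family_disjointed
      by (rule disjoint_family_on_mono[rotated]) simp
    have diam: "dist x y \<le> 2 * \<epsilon>" if "x \<in> Q k" "y \<in> Q k" for x y k
    proof -
      have "dist (f k) x \<le> \<epsilon>" "dist (f k) y \<le> \<epsilon>" using that sub[of k] by auto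
      then show ?thesis using dist_triangle3[of x y "f k"] by linarith
    qed
    show "\<exists>n Q. 0 < n \<and> real n \<le> C * (1 / \<epsilon>) ^ d \<and> disjoint_family_on Q {..<n} \<and> (\<Union>k<n. Q k) = K \<and>
      (\<forall>k<n. Q k \<in> sets borel \<and> (\<forall>x\<in>Q k. \<forall>y\<in>Q k. dist x y \<le> 2 * \<epsilon>))"
      using n un disj meas diam F(3) unfolding n_def[symmetric] by blast
  qed
qed

section \<open>Locally Lipschitz functions on compact products\<close>

lemma compact_PiE_UNIV:
  fixes K :: "'i \<Rightarrow> 'a::topological_space set"
  assumes "\<And>i. compact (K i)"
  shows "compact (\<Pi>\<^sub>E i\<in>UNIV. K i)"
proof -
  have "compactin (product_topology (\<lambda>i. euclidean) UNIV) (\<Pi>\<^sub>E i\<in>UNIV. K i)"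
    using assms by (simp add: compactin_PiE)
  then show ?thesis by (simp add: euclidean_product_topology)
qed

lemma max_dist_less_iff: "max_dist x y < r \<longleftrightarrow> (\<forall>i. dist (x i) (y i) < r)"
  unfolding max_dist_def by (subst Max_less_iff) auto

lemma max_dist_le_iff: "max_dist x y \<le> r \<longleftrightarrow> (\<forall>i. dist (x i) (y i) \<le> r)"
  unfolding max_dist_def by (subst Max_le_iff) auto

lemma max_dist_nonneg: "0 \<le> max_dist x y"
proof -
  have "0 \<le> dist (x undefined) (y undefined)" by simp
  also have "\<dots> \<le> max_dist x y" unfolding max_dist_def by (intro Max_ge) auto
  finally show ?thesis .
qed

lemma max_dist_triangle: "max_dist x z \<le> max_dist x y + max_dist y z"
proof -
  have "dist (x i) (z i) \<le> max_dist x y + max_dist y z" for i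
  proof -
    have "dist (x i) (y i) \<le> max_dist x y" "dist (y i) (z i) \<le> max_dist y z"
      using max_dist_le_iff[of x y "max_dist x y"] max_dist_le_iff[of y z "max_dist y z"] by auto
    then show ?thesis using dist_triangle[of "x i" "z i" "y i"] by linarith
  qed
  then show ?thesis by (simp add: max_dist_le_iff)
qed

text \<open>The scale \<open>\<delta>\<close> is a Lebesgue number of a cover by balls on which \<open>f\<close> is Lipschitz.\<close>

lemma locally_lipschitz_on_compact:
  assumes f: "locally_lipschitz_on S f" and K: "K \<subseteq> S" "compact K"
  obtains L \<delta> where "0 \<le> L" "0 < \<delta>"
    "\<And>x y. x \<in> K \<Longrightarrow> y \<in> K \<Longrightarrow> max_dist x y < \<delta> \<Longrightarrow> \<bar>f x - f y\<bar> \<le> L * max_dist x y"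
proof -
  have "\<exists>r L. r > 0 \<and> (\<forall>y\<in>S. \<forall>z\<in>S.
       max_dist x y < r \<longrightarrow> max_dist x z < r \<longrightarrow> \<bar>f y - f z\<bar> \<le> L * max_dist y z)" if "x \<in> S" for x
    using f that unfolding locally_lipschitz_on_def by blast
  then obtain r L where r: "\<And>x. x \<in> S \<Longrightarrow> r x > 0"
    and L: "\<And>x y z. \<lbrakk>x \<in> S; y \<in> S; z \<in> S; max_dist x y < r x; max_dist x z < r x\<rbrakk> \<Longrightarrow>
        \<bar>f y - f z\<bar> \<le> L x * max_dist y z"
    by metis
  define U where "U x = {y. max_dist x y < r x / 2}" for x
  have openU: "open (U x)" for x
  proof -
    have "U x = (\<Pi>\<^sub>E i\<in>UNIV. ball (x i) (r x / 2))"
      unfolding U_def max_dist_less_iff by (auto simp: PiE_iff)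
    then show ?thesis by (simp add: open_PiE)
  qed
  have "x \<in> U x" if "x \<in> K" for x using r[of x] that K(1) unfolding U_def max_dist_less_iff by auto
  then have "K \<subseteq> (\<Union>p\<in>K. U p)" by blast
  then obtain P where P: "P \<subseteq> K" "finite P" "K \<subseteq> (\<Union>p\<in>P. U p)"
    by (rule compactE_image[OF K(2) openU])
  define \<delta> where "\<delta> = Min (insert 1 ((\<lambda>p. r p / 2) ` P))"
  \<comment> \<open>The local constants may be negative, hence the extra \<open>0\<close>.\<close>
  define M where "M = Max (insert 0 (L ` P))"
  show thesis
  proof (rule that[of M \<delta>])
    show "0 \<le> M" unfolding M_def using P(2) by (intro Max_ge) auto
    show "0 < \<delta>" unfolding \<delta>_def using P(1,2) r K(1) by (subst Min_gr_iff) auto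
    fix x y assume xy: "x \<in> K" "y \<in> K" "max_dist x y < \<delta>"
    obtain p where p: "p \<in> P" "max_dist p x < r p / 2" using P(3) xy(1) by (auto simp: U_def)
    have "\<delta> \<le> r p / 2" unfolding \<delta>_def using P(2) p(1) by (intro Min_le) auto
    then have "max_dist p y < r p" using max_dist_triangle[of p y x] p(2) xy(3) by linarith
    moreover have "max_dist p x < r p" using p max_dist_nonneg[of p x] by linarith
    ultimately have "\<bar>f x - f y\<bar> \<le> L p * max_dist x y"
      using L[of p x y] p(1) P(1) K(1) xy by blast
    also have "\<dots> \<le> M * max_dist x y"
      unfolding M_def using P(2) p(1) by (intro mult_right_mono Max_ge max_dist_nonneg) auto
    finally show "\<bar>f x - f y\<bar> \<le> M * max_dist x y" .
  qed
qed

section \<open>Shannon entropy and integrals\<close>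

text \<open>The Shannon entropy of a distribution on a finite set is largest for the uniform one.\<close>

lemma sum_neg_ln_le_ln_card:
  fixes p :: "'a \<Rightarrow> real"
  assumes "finite A" "\<And>a. a \<in> A \<Longrightarrow> 0 \<le> p a" "sum p A = 1"
  shows "(\<Sum>a\<in>A. p a * (- ln (p a))) \<le> ln (card A)"
proof -
  have N: "real (card A) > 0" using assms by (cases "A = {}") (auto simp: card_gt_0_iff)
  have "p a * (- ln (p a)) \<le> p a * ln (card A) + (1 / card A - p a)" if a: "a \<in> A" for a
  proof (cases "p a = 0")
    case False
    then have pos: "p a > 0" using assms(2)[OF a] by simp
    have "ln (1 / (p a * card A)) \<le> 1 / (p a * card A) - 1"
      using pos N by (intro ln_le_minus_one) simp
    then have "- ln (p a) \<le> ln (card A) + (1 / (p a * card A) - 1)"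
      using pos N by (simp add: ln_div ln_mult)
    then have "p a * (- ln (p a)) \<le> p a * (ln (card A) + (1 / (p a * card A) - 1))"
      using pos by (intro mult_left_mono) auto
    also have "\<dots> = p a * ln (card A) + (1 / card A - p a)"
      using pos N by (simp add: field_simps)
    finally show ?thesis .
  qed (use N in simp)
  then have "(\<Sum>a\<in>A. p a * (- ln (p a))) \<le> (\<Sum>a\<in>A. p a * ln (card A) + (1 / card A - p a))"
    by (rule sum_mono)
  also have "\<dots> = sum p A * ln (card A) + (card A * (1 / card A) - sum p A)"
    by (simp add: sum.distrib sum_subtractf sum_distrib_right)
  also have "\<dots> = ln (card A)" using N assms(3) by simp
  finally show ?thesis .
qed

lemma ext_integral_nonneg:
  assumes "\<And>x. x \<in> space M \<Longrightarrow> 0 \<le> f x"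
  shows "ext_integral M f = enn2ereal (\<integral>\<^sup>+x. ennreal (f x) \<partial>M)"
proof -
  have "(\<integral>\<^sup>+x. ennreal (- f x) \<partial>M) = (\<integral>\<^sup>+x. 0 \<partial>M)"
    using assms by (intro nn_integral_cong) (simp add: ennreal_neg)
  then show ?thesis by (simp add: ext_integral_def zero_ennreal.rep_eq)
qed

lemma ext_integral_integrable:
  assumes "integrable M f"
  shows "ext_integral M f = ereal (integral\<^sup>L M f)"
proof -
  obtain r q where rq: "0 \<le> r" "0 \<le> q" "(\<integral>\<^sup>+x. ennreal (f x) \<partial>M) = ennreal r"
    "(\<integral>\<^sup>+x. ennreal (- f x) \<partial>M) = ennreal q" "integral\<^sup>L M f = r - q"
    using integrableE[OF assms] by metis
  then show ?thesis by (simp add: ext_integral_def enn2ereal_ennreal)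
qed

lemma ext_integral_cong_AE:
  assumes "AE x in M. f x = g x"
  shows "ext_integral M f = ext_integral M g"
proof -
  have "(\<integral>\<^sup>+x. ennreal (f x) \<partial>M) = (\<integral>\<^sup>+x. ennreal (g x) \<partial>M)"
    by (rule nn_integral_cong_AE) (use assms in eventually_elim, simp)
  moreover have "(\<integral>\<^sup>+x. ennreal (- f x) \<partial>M) = (\<integral>\<^sup>+x. ennreal (- g x) \<partial>M)"
    by (rule nn_integral_cong_AE) (use assms in eventually_elim, simp)
  ultimately show ?thesis by (simp add: ext_integral_def)
qed

lemma sum_indicator_disjoint:
  fixes f :: "'k \<Rightarrow> real"
  assumes "finite I" "disjoint_family_on A I" "k \<in> I" "x \<in> A k"
  shows "(\<Sum>j\<in>I. f j * indicator (A j) x) = f k"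
proof -
  have "(\<Sum>j\<in>I. f j * indicator (A j) x) = (\<Sum>j\<in>I. if j = k then f k else 0)"
    using assms by (intro sum.cong) (auto simp: disjoint_family_on_def indicator_def)
  then show ?thesis using assms by simp
qed

text \<open>
  Two probability measures with the same masses on the cells of a partition integrate \<open>c\<close> to the same
  value up to the oscillation of \<open>c\<close> on a cell. Both integrals are compared with sums of
  infima over the cells, so \<open>c\<close> need not be measurable.
\<close>

lemma nn_integral_le_of_equal_cells:
  fixes c :: "'a \<Rightarrow> real"
  assumes M: "prob_space M" and N: "prob_space N"
    and I: "finite I" and A: "\<And>k. k \<in> I \<Longrightarrow> A k \<in> sets M" "\<And>k. k \<in> I \<Longrightarrow> A k \<in> sets N"
    and disj: "disjoint_family_on A I"
    and eq: "\<And>k. k \<in> I \<Longrightarrow> measure M (A k) = measure N (A k)"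
    and AE: "AE x in N. x \<in> (\<Union>k\<in>I. A k)"
    and nonneg: "\<And>k x. k \<in> I \<Longrightarrow> x \<in> A k \<Longrightarrow> 0 \<le> c x"
    and osc: "\<And>k x y. k \<in> I \<Longrightarrow> x \<in> A k \<Longrightarrow> y \<in> A k \<Longrightarrow> c x \<le> c y + \<eta>"
    and \<eta>: "0 \<le> \<eta>"
  shows "(\<integral>\<^sup>+x. ennreal (c x) \<partial>N) \<le> (\<integral>\<^sup>+x. ennreal (c x) \<partial>M) + ennreal \<eta>"
proof -
  interpret M: prob_space M by fact
  interpret N: prob_space N by fact
  define m where "m k = (if A k = {} then 0 else Inf (c ` A k))" for k
  have m0: "0 \<le> m k" if "k \<in> I" for k
    using nonneg[OF that] by (auto simp: m_def intro!: cInf_greatest)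
  have m_le: "m k \<le> c x" if k: "k \<in> I" and x: "x \<in> A k" for k x
  proof -
    have "bdd_below (c ` A k)" using nonneg[OF k] by (intro bdd_belowI[of _ 0]) auto
    then show ?thesis using x by (auto simp: m_def intro!: cInf_lower)
  qed
  have le_m: "c x \<le> m k + \<eta>" if k: "k \<in> I" and x: "x \<in> A k" for k x
  proof -
    have "c x - \<eta> \<le> Inf (c ` A k)"
      using x osc[OF k x] by (intro cInf_greatest) (auto simp: algebra_simps)
    then show ?thesis using x by (auto simp: m_def)
  qed
  have val: "(\<Sum>j\<in>I. ennreal (f j) * indicator (A j) x) = ennreal (f k)"
    if k: "k \<in> I" "x \<in> A k" for f k x
  proof -
    have "(\<Sum>j\<in>I. ennreal (f j) * indicator (A j) x) = (\<Sum>j\<in>I. if j = k then ennreal (f k) else 0)"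
      using k disj by (intro sum.cong) (auto simp: disjoint_family_on_def indicator_def)
    then show ?thesis using I k by simp
  qed
  have "(\<integral>\<^sup>+x. ennreal (c x) \<partial>N) \<le> (\<integral>\<^sup>+x. (\<Sum>k\<in>I. ennreal (m k + \<eta>) * indicator (A k) x) \<partial>N)"
  proof (rule nn_integral_mono_AE, use AE in eventually_elim)
    fix x assume "x \<in> (\<Union>k\<in>I. A k)"
    then obtain k where k: "k \<in> I" "x \<in> A k" by blast
    show "ennreal (c x) \<le> (\<Sum>k\<in>I. ennreal (m k + \<eta>) * indicator (A k) x)"
      unfolding val[OF k] using le_m[OF k] by (rule ennreal_leI)
  qed
  also have "\<dots> = (\<Sum>k\<in>I. ennreal (m k + \<eta>) * emeasure N (A k))"
    using A by (subst nn_integral_sum) (auto simp: nn_integral_cmult_indicator)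
  also have "\<dots> = (\<Sum>k\<in>I. ennreal (m k) * emeasure M (A k)) + ennreal \<eta> * (\<Sum>k\<in>I. emeasure N (A k))"
  proof -
    have "ennreal (m k + \<eta>) * emeasure N (A k)
        = ennreal (m k) * emeasure M (A k) + ennreal \<eta> * emeasure N (A k)" if "k \<in> I" for k
      using m0[OF that] \<eta> eq[OF that]
      by (simp add: ennreal_plus distrib_right M.emeasure_eq_measure N.emeasure_eq_measure)
    then show ?thesis unfolding sum_distrib_left sum.distrib[symmetric] by (intro sum.cong refl)
  qed
  also have "(\<Sum>k\<in>I. ennreal (m k) * emeasure M (A k))
      = (\<integral>\<^sup>+x. (\<Sum>k\<in>I. ennreal (m k) * indicator (A k) x) \<partial>M)"
    using A by (subst nn_integral_sum) (auto simp: nn_integral_cmult_indicator)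
  also have "\<dots> \<le> (\<integral>\<^sup>+x. ennreal (c x) \<partial>M)"
  proof (rule nn_integral_mono)
    fix x
    show "(\<Sum>k\<in>I. ennreal (m k) * indicator (A k) x) \<le> ennreal (c x)"
    proof (cases "\<exists>k\<in>I. x \<in> A k")
      case True
      then obtain k where k: "k \<in> I" "x \<in> A k" by blast
      show ?thesis unfolding val[OF k] using m_le[OF k] by (rule ennreal_leI)
    next
      case False
      then have "(\<Sum>k\<in>I. ennreal (m k) * indicator (A k) x) = 0" by (intro sum.neutral) auto
      then show ?thesis by simp
    qed
  qed
  also have "(\<Sum>k\<in>I. emeasure N (A k)) = emeasure N (\<Union>k\<in>I. A k)"
    using I A disj by (intro sum_emeasure) auto
  also have "\<dots> \<le> 1" by (rule N.emeasure_le_1)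
  finally show ?thesis by (simp add: add_mono mult_left_mono)
qed

section \<open>Block approximation of a coupling\<close>

text \<open>
  A coupling \<open>\<gamma>\<close> of finitely many probability measures \<open>\<mu> i\<close>, together with disjoint measurable cells
  \<open>Q i l\<close>, for \<open>l < n i\<close>, that carry the full mass of \<open>\<mu> i\<close>.
\<close>

locale block_approximation =
  fixes \<mu> :: "'i::finite \<Rightarrow> 'a measure" and \<gamma> :: "('i \<Rightarrow> 'a) measure"
    and n :: "'i \<Rightarrow> nat" and Q :: "'i \<Rightarrow> nat \<Rightarrow> 'a set"
  assumes prob_marginals: "\<And>i. prob_space (\<mu> i)"
    and prob_coupling: "prob_space \<gamma>"
    and sets_coupling: "sets \<gamma> = sets (PiM UNIV \<mu>)"
    and marginals: "\<And>i. distr \<gamma> (\<mu> i) (\<lambda>x. x i) = \<mu> i"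
    and sets_cells: "\<And>i l. l < n i \<Longrightarrow> Q i l \<in> sets (\<mu> i)"
    and disjoint_cells: "\<And>i. disjoint_family_on (Q i) {..<n i}"
    and full_cells: "\<And>i. measure (\<mu> i) (\<Union>l<n i. Q i l) = 1"
begin

sublocale marginal: prob_space "\<mu> i" for i
  by (rule prob_marginals)

sublocale coupling: prob_space \<gamma>
  by (rule prob_coupling)

sublocale reference: finite_product_prob_space \<mu> UNIV
  by standard simp

abbreviation indices :: "('i \<Rightarrow> nat) set"
  where "indices \<equiv> \<Pi>\<^sub>E i\<in>UNIV. {..<n i}"

text \<open>The product cell with multi-index \<open>k\<close>.\<close>

definition cell :: "('i \<Rightarrow> nat) \<Rightarrow> ('i \<Rightarrow> 'a) set"
  where "cell k = (\<Pi>\<^sub>E i\<in>UNIV. Q i (k i))"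

text \<open>
  The value of the new density on a cell. A cell that is null for the product measure gets \<open>0\<close> by the
  convention for division; it is also null for \<open>\<gamma>\<close> (\<open>measure_coupling_cell_eq_0\<close>).
\<close>

definition weight :: "('i \<Rightarrow> nat) \<Rightarrow> real"
  where "weight k = measure \<gamma> (cell k) / measure (PiM UNIV \<mu>) (cell k)"

text \<open>
  The block approximation: on each cell it is proportional to the product measure, and it gives the
  cell the same mass as \<open>\<gamma>\<close>.
\<close>

definition block :: "('i \<Rightarrow> 'a) measure"
  where "block = density (PiM UNIV \<mu>) (\<lambda>x. ennreal (\<Sum>k\<in>indices. weight k * indicator (cell k) x))"

lemma finite_indices: "finite indices"
  by (intro finite_PiE) auto

lemma index_less: "k \<in> indices \<Longrightarrow> k i < n i"
  by (auto simp: PiE_iff)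

lemma space_coupling: "space \<gamma> = (\<Pi>\<^sub>E i\<in>UNIV. space (\<mu> i))"
  using sets_eq_imp_space_eq[OF sets_coupling] by (simp add: space_PiM)

lemma sets_cell: "k \<in> indices \<Longrightarrow> cell k \<in> sets (PiM UNIV \<mu>)"
  unfolding cell_def by (intro sets_PiM_I_finite) (auto intro: sets_cells index_less)

lemma disjoint_cell: "disjoint_family_on cell indices"
  unfolding disjoint_family_on_def
proof (intro ballI impI)
  fix k k' assume k: "k \<in> indices" "k' \<in> indices" "k \<noteq> k'"
  then obtain i where "k i \<noteq> k' i" by blast
  then have "Q i (k i) \<inter> Q i (k' i) = {}"
    using disjoint_cells[of i] k(1,2) by (auto simp: disjoint_family_on_def index_less)
  then show "cell k \<inter> cell k' = {}" by (auto simp: cell_def PiE_iff)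
qed

lemma measurable_coordinate:
  assumes "sets \<kappa> = sets (PiM UNIV \<mu>)"
  shows "(\<lambda>x. x i) \<in> measurable \<kappa> (\<mu> i)"
  by (simp add: measurable_cong_sets[OF assms refl] measurable_component_singleton)

lemma AE_in_cells:
  assumes sets: "sets \<kappa> = sets (PiM UNIV \<mu>)" and marg: "\<And>i. distr \<kappa> (\<mu> i) (\<lambda>x. x i) = \<mu> i"
  shows "AE x in \<kappa>. x \<in> (\<Union>k\<in>indices. cell k)"
proof -
  have "AE x in \<kappa>. x i \<in> (\<Union>l<n i. Q i l)" for i
  proof (rule AE_distrD[OF measurable_coordinate[OF sets]])
    have U: "(\<Union>l<n i. Q i l) \<in> sets (\<mu> i)" using sets_cells by auto
    show "AE y in distr \<kappa> (\<mu> i) (\<lambda>x. x i). y \<in> (\<Union>l<n i. Q i l)"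
      unfolding marg using marginal.prob_eq_1[OF U] full_cells by simp
  qed
  then have "AE x in \<kappa>. \<forall>i. x i \<in> (\<Union>l<n i. Q i l)" by (simp add: AE_all_countable)
  then show ?thesis
  proof eventually_elim
    fix x assume "\<forall>i. x i \<in> (\<Union>l<n i. Q i l)"
    then have "\<forall>i. \<exists>l. l < n i \<and> x i \<in> Q i l" by blast
    then obtain k where k: "\<And>i. k i < n i \<and> x i \<in> Q i (k i)" using choice by metis
    then have "k \<in> indices" "x \<in> cell k" by (auto simp: cell_def PiE_iff)
    then show "x \<in> (\<Union>k\<in>indices. cell k)" by blast
  qed
qed

lemma AE_coupling_cells: "AE x in \<gamma>. x \<in> (\<Union>k\<in>indices. cell k)"
  using sets_coupling marginals by (rule AE_in_cells)

text \<open>Summing \<open>\<gamma>\<close> over the product cells with fixed \<open>i\<close>-th factor recovers the \<open>i\<close>-th marginal.\<close>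

lemma sum_measure_slice:
  assumes l: "l < n i"
  shows "(\<Sum>k\<in>{k \<in> indices. k i = l}. measure \<gamma> (cell k)) = measure (\<mu> i) (Q i l)"
proof -
  let ?J = "{k \<in> indices. k i = l}"
  have "(\<Sum>k\<in>?J. measure \<gamma> (cell k)) = measure \<gamma> (\<Union>k\<in>?J. cell k)"
    using finite_indices sets_cell disjoint_cell
    by (intro coupling.finite_measure_finite_Union[symmetric])
       (auto simp: sets_coupling intro: disjoint_family_on_mono[of _ indices])
  also have "\<dots> = measure \<gamma> ((\<lambda>x. x i) -` Q i l \<inter> space \<gamma>)"
  proof (rule measure_eq_AE)
    show "AE x in \<gamma>. (x \<in> (\<Union>k\<in>?J. cell k)) = (x \<in> (\<lambda>x. x i) -` Q i l \<inter> space \<gamma>)"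
      using AE_coupling_cells AE_space
    proof eventually_elim
      fix x assume x: "x \<in> (\<Union>k\<in>indices. cell k)" "x \<in> space \<gamma>"
      then obtain k where k: "k \<in> indices" "x \<in> cell k" by blast
      have xi: "x i \<in> Q i (k i)" using k(2) by (auto simp: cell_def PiE_iff)
      show "(x \<in> (\<Union>k\<in>?J. cell k)) = (x \<in> (\<lambda>x. x i) -` Q i l \<inter> space \<gamma>)"
      proof
        assume "x \<in> (\<Union>k\<in>?J. cell k)"
        then show "x \<in> (\<lambda>x. x i) -` Q i l \<inter> space \<gamma>" using x(2) by (auto simp: cell_def PiE_iff)
      next
        assume "x \<in> (\<lambda>x. x i) -` Q i l \<inter> space \<gamma>"
        then have "x i \<in> Q i l" by simp
        with xi have "k i = l"
          using disjoint_cells[of i] l index_less[OF k(1), of i]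
          by (auto simp: disjoint_family_on_def)
        then show "x \<in> (\<Union>k\<in>?J. cell k)" using k by blast
      qed
    qed
    have "finite ?J" using finite_indices by simp
    then show "(\<Union>k\<in>?J. cell k) \<in> sets \<gamma>"
      unfolding sets_coupling using sets_cell by (intro sets.finite_UN) auto
    show "(\<lambda>x. x i) -` Q i l \<inter> space \<gamma> \<in> sets \<gamma>"
      using measurable_coordinate[OF sets_coupling] sets_cells[OF l] by (rule measurable_sets)
  qed
  also have "\<dots> = measure (distr \<gamma> (\<mu> i) (\<lambda>x. x i)) (Q i l)"
    using measurable_coordinate[OF sets_coupling] sets_cells[OF l] by (simp add: measure_distr)
  finally show ?thesis by (simp add: marginals)
qed

lemma sum_cells_component:
  fixes g :: "nat \<Rightarrow> real"
  shows "(\<Sum>k\<in>indices. measure \<gamma> (cell k) * g (k i)) = (\<Sum>l<n i. measure (\<mu> i) (Q i l) * g l)"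
proof -
  have "(\<Sum>k\<in>indices. measure \<gamma> (cell k) * g (k i))
      = (\<Sum>l<n i. \<Sum>k\<in>{k \<in> indices. k i = l}. measure \<gamma> (cell k) * g (k i))"
    using finite_indices by (intro sum.group[symmetric]) (auto simp: index_less)
  also have "\<dots> = (\<Sum>l<n i. (\<Sum>k\<in>{k \<in> indices. k i = l}. measure \<gamma> (cell k)) * g l)"
    by (simp add: sum_distrib_right)
  also have "\<dots> = (\<Sum>l<n i. measure (\<mu> i) (Q i l) * g l)"
    by (intro sum.cong) (auto simp: sum_measure_slice)
  finally show ?thesis .
qed

lemma measure_reference_cell:
  "k \<in> indices \<Longrightarrow> measure (PiM UNIV \<mu>) (cell k) = (\<Prod>i\<in>UNIV. measure (\<mu> i) (Q i (k i)))"
  unfolding cell_def by (intro reference.prob_times) (auto intro: sets_cells index_less)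

lemma measure_coupling_cell_le:
  assumes k: "k \<in> indices"
  shows "measure \<gamma> (cell k) \<le> measure (\<mu> i) (Q i (k i))"
proof -
  have Qs: "Q i (k i) \<in> sets (\<mu> i)" using sets_cells index_less[OF k] by blast
  have meas: "(\<lambda>x. x i) -` Q i (k i) \<inter> space \<gamma> \<in> sets \<gamma>"
    using measurable_coordinate[OF sets_coupling] Qs by (rule measurable_sets)
  have "cell k \<subseteq> (\<lambda>x. x i) -` Q i (k i) \<inter> space \<gamma>"
    using sets.sets_into_space[OF sets_cell[OF k]] sets_eq_imp_space_eq[OF sets_coupling]
    by (auto simp: cell_def PiE_iff)
  then have "measure \<gamma> (cell k) \<le> measure \<gamma> ((\<lambda>x. x i) -` Q i (k i) \<inter> space \<gamma>)"
    using meas by (rule coupling.finite_measure_mono)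
  also have "\<dots> = measure (distr \<gamma> (\<mu> i) (\<lambda>x. x i)) (Q i (k i))"
    using measurable_coordinate[OF sets_coupling] Qs by (simp add: measure_distr)
  finally show ?thesis by (simp add: marginals)
qed

lemma measure_coupling_cell_eq_0:
  assumes k: "k \<in> indices" and 0: "measure (PiM UNIV \<mu>) (cell k) = 0"
  shows "measure \<gamma> (cell k) = 0"
proof -
  obtain i where "measure (\<mu> i) (Q i (k i)) = 0"
    using 0 unfolding measure_reference_cell[OF k] by auto
  then show ?thesis using measure_coupling_cell_le[OF k, of i] by (simp add: measure_le_0_iff)
qed

lemma weight_nonneg: "0 \<le> weight k"
  by (simp add: weight_def)

lemma weight_mult: "k \<in> indices \<Longrightarrow> weight k * measure (PiM UNIV \<mu>) (cell k) = measure \<gamma> (cell k)"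
  using measure_coupling_cell_eq_0[of k] by (cases "measure (PiM UNIV \<mu>) (cell k) = 0") (auto simp: weight_def)

lemma borel_density: "(\<lambda>x. \<Sum>k\<in>indices. weight k * indicator (cell k) x) \<in> borel_measurable (PiM UNIV \<mu>)"
  using sets_cell by (intro borel_measurable_sum borel_measurable_times borel_measurable_indicator) auto

lemma sets_block [simp]: "sets block = sets (PiM UNIV \<mu>)"
  by (simp add: block_def)

lemma emeasure_block:
  assumes S: "S \<in> sets (PiM UNIV \<mu>)"
  shows "emeasure block S = ennreal (\<Sum>k\<in>indices. weight k * measure (PiM UNIV \<mu>) (cell k \<inter> S))"
proof -
  have m: "cell k \<inter> S \<in> sets (PiM UNIV \<mu>)" if "k \<in> indices" for k
    using sets_cell[OF that] S by auto
  have "emeasure block S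
      = (\<integral>\<^sup>+x. ennreal (\<Sum>k\<in>indices. weight k * indicator (cell k) x) * indicator S x \<partial>PiM UNIV \<mu>)"
    unfolding block_def using borel_density S by (subst emeasure_density) auto
  also have "\<dots> = (\<integral>\<^sup>+x. (\<Sum>k\<in>indices. ennreal (weight k) * indicator (cell k \<inter> S) x) \<partial>PiM UNIV \<mu>)"
  proof (intro nn_integral_cong)
    fix x
    have "(\<Sum>k\<in>indices. ennreal (weight k) * indicator (cell k \<inter> S) x)
        = (\<Sum>k\<in>indices. ennreal (weight k * indicator (cell k) x)) * indicator S x"
      unfolding sum_distrib_right by (intro sum.cong) (auto simp: indicator_def)
    also have "\<dots> = ennreal (\<Sum>k\<in>indices. weight k * indicator (cell k) x) * indicator S x"
      by (subst sum_ennreal) (auto simp: weight_nonneg)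
    finally show "ennreal (\<Sum>k\<in>indices. weight k * indicator (cell k) x) * indicator S x
        = (\<Sum>k\<in>indices. ennreal (weight k) * indicator (cell k \<inter> S) x)" by simp
  qed
  also have "\<dots> = (\<Sum>k\<in>indices. ennreal (weight k) * emeasure (PiM UNIV \<mu>) (cell k \<inter> S))"
    using m by (subst nn_integral_sum) (auto simp: nn_integral_cmult_indicator)
  also have "\<dots> = (\<Sum>k\<in>indices. ennreal (weight k * measure (PiM UNIV \<mu>) (cell k \<inter> S)))"
    by (simp add: reference.emeasure_eq_measure ennreal_mult weight_nonneg)
  also have "\<dots> = ennreal (\<Sum>k\<in>indices. weight k * measure (PiM UNIV \<mu>) (cell k \<inter> S))"
    by (intro sum_ennreal) (auto simp: weight_nonneg)
  finally show ?thesis .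
qed

lemma measure_block_cell:
  assumes k: "k \<in> indices"
  shows "measure block (cell k) = measure \<gamma> (cell k)"
proof -
  have "(\<Sum>j\<in>indices. weight j * measure (PiM UNIV \<mu>) (cell j \<inter> cell k))
      = (\<Sum>j\<in>indices. if j = k then measure \<gamma> (cell k) else 0)"
    using disjoint_cell k weight_mult[OF k]
    by (intro sum.cong) (auto simp: disjoint_family_on_def)
  also have "\<dots> = measure \<gamma> (cell k)" using finite_indices k by simp
  finally show ?thesis
    using emeasure_block[OF sets_cell[OF k]] by (simp add: measure_def)
qed

text \<open>
  On a cell \<open>Q\<close> the new measure has \<open>i\<close>-th marginal \<open>\<gamma> Q\<close> times the normalised restriction of
  \<open>\<mu> i\<close> to the \<open>i\<close>-th factor of \<open>Q\<close>; summing over the other indices reassembles \<open>\<mu> i\<close>.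
\<close>

lemma marginal_block: "distr block (\<mu> i) (\<lambda>x. x i) = \<mu> i"
proof (rule measure_eqI)
  fix A assume "A \<in> sets (distr block (\<mu> i) (\<lambda>x. x i))"
  then have A: "A \<in> sets (\<mu> i)" by simp
  let ?S = "(\<lambda>x. x i) -` A \<inter> space (PiM UNIV \<mu>)"
  have S: "?S \<in> sets (PiM UNIV \<mu>)"
    using measurable_component_singleton[of i UNIV \<mu>] A by (intro measurable_sets) auto
  have term_eq: "weight k * measure (PiM UNIV \<mu>) (cell k \<inter> ?S)
      = measure \<gamma> (cell k) * (measure (\<mu> i) (Q i (k i) \<inter> A) / measure (\<mu> i) (Q i (k i)))"
    if k: "k \<in> indices" for k
  proof -
    let ?B = "\<lambda>j. if j = i then Q i (k i) \<inter> A else Q j (k j)"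
    let ?R = "\<Prod>j\<in>UNIV - {i}. measure (\<mu> j) (Q j (k j))"
    have "cell k \<inter> ?S = cell k \<inter> (\<lambda>x. x i) -` A"
      using sets.sets_into_space[OF sets_cell[OF k]] by auto
    also have "\<dots> = (\<Pi>\<^sub>E j\<in>UNIV. ?B j)"
      by (auto simp: cell_def PiE_iff split: if_splits)
    also have "measure (PiM UNIV \<mu>) \<dots> = (\<Prod>j\<in>UNIV. measure (\<mu> j) (?B j))"
      using A by (intro reference.prob_times) (auto intro!: sets_cells index_less[OF k])
    also have "\<dots> = measure (\<mu> i) (Q i (k i) \<inter> A) * ?R"
      by (subst prod.remove[of _ i]) (auto intro!: prod.cong)
    finally have 1: "measure (PiM UNIV \<mu>) (cell k \<inter> ?S) = measure (\<mu> i) (Q i (k i) \<inter> A) * ?R" .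
    have 2: "measure (PiM UNIV \<mu>) (cell k) = measure (\<mu> i) (Q i (k i)) * ?R"
      unfolding measure_reference_cell[OF k] by (subst prod.remove[of _ i]) auto
    show ?thesis
    proof (cases "measure (PiM UNIV \<mu>) (cell k) = 0")
      case True
      then show ?thesis using measure_coupling_cell_eq_0[OF k True] by (simp add: weight_def)
    next
      case False
      then show ?thesis unfolding weight_def 1 2 by simp
    qed
  qed
  have "(\<Sum>k\<in>indices. weight k * measure (PiM UNIV \<mu>) (cell k \<inter> ?S))
      = (\<Sum>k\<in>indices. measure \<gamma> (cell k) *
          (measure (\<mu> i) (Q i (k i) \<inter> A) / measure (\<mu> i) (Q i (k i))))"
    by (intro sum.cong refl term_eq)
  also have "\<dots> = (\<Sum>l<n i. measure (\<mu> i) (Q i l) *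
          (measure (\<mu> i) (Q i l \<inter> A) / measure (\<mu> i) (Q i l)))"
    by (rule sum_cells_component)
  also have "\<dots> = (\<Sum>l<n i. measure (\<mu> i) (Q i l \<inter> A))"
  proof (intro sum.cong refl)
    fix l assume "l \<in> {..<n i}"
    then have "measure (\<mu> i) (Q i l \<inter> A) \<le> measure (\<mu> i) (Q i l)"
      using sets_cells by (intro marginal.finite_measure_mono) auto
    then show "measure (\<mu> i) (Q i l) * (measure (\<mu> i) (Q i l \<inter> A) / measure (\<mu> i) (Q i l))
        = measure (\<mu> i) (Q i l \<inter> A)"
      by (cases "measure (\<mu> i) (Q i l) = 0") (auto simp: measure_le_0_iff)
  qed
  also have "\<dots> = measure (\<mu> i) (\<Union>l<n i. Q i l \<inter> A)"
  proof (rule marginal.finite_measure_finite_Union[symmetric])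
    show "disjoint_family_on (\<lambda>l. Q i l \<inter> A) {..<n i}"
      using disjoint_cells[of i] unfolding disjoint_family_on_def by blast
  qed (use sets_cells A in auto)
  also have "\<dots> = measure (\<mu> i) A"
  proof (rule measure_eq_AE)
    have U: "(\<Union>l<n i. Q i l) \<in> sets (\<mu> i)" using sets_cells by auto
    have "AE x in \<mu> i. x \<in> (\<Union>l<n i. Q i l)"
      using marginal.prob_eq_1[OF U] full_cells by simp
    then show "AE x in \<mu> i. (x \<in> (\<Union>l<n i. Q i l \<inter> A)) = (x \<in> A)"
      by eventually_elim auto
    show "(\<Union>l<n i. Q i l \<inter> A) \<in> sets (\<mu> i)" using sets_cells A by auto
  qed (rule A)
  finally have "emeasure block ?S = ennreal (measure (\<mu> i) A)"
    by (simp add: emeasure_block[OF S])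
  moreover have "emeasure (distr block (\<mu> i) (\<lambda>x. x i)) A = emeasure block ?S"
    using measurable_coordinate[OF sets_block] A
    by (simp add: emeasure_distr sets_eq_imp_space_eq[OF sets_block])
  ultimately show "emeasure (distr block (\<mu> i) (\<lambda>x. x i)) A = emeasure (\<mu> i) A"
    by (simp add: marginal.emeasure_eq_measure)
qed simp

lemma prob_space_block: "prob_space block"
proof -
  have "prob_space (distr block (\<mu> i) (\<lambda>x. x i))" for i
    unfolding marginal_block by (rule prob_marginals)
  then show ?thesis
    by (rule prob_space_distrD[rotated, OF _ measurable_coordinate[OF sets_block]])
qed

lemma rel_entropy_block:
  "rel_entropy block (PiM UNIV \<mu>) = ereal (\<Sum>k\<in>indices. measure \<gamma> (cell k) * ln (weight k))"
proof -
  let ?P = "PiM UNIV \<mu>"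
  let ?r = "\<lambda>x. \<Sum>k\<in>indices. weight k * indicator (cell k) x"
  let ?h = "\<lambda>x. \<Sum>k\<in>indices. (weight k * ln (weight k)) * indicator (cell k) x"
  have r_meas: "(\<lambda>x. ennreal (?r x)) \<in> borel_measurable ?P" using borel_density by simp
  have r_nonneg: "0 \<le> ?r x" for x by (intro sum_nonneg) (auto simp: weight_nonneg)
  have "AE x in ?P. ennreal (?r x) = RN_deriv ?P block x"
    by (rule reference.RN_deriv_unique[OF r_meas]) (simp add: block_def)
  moreover have "AE x in ?P. x \<in> (\<Union>k\<in>indices. cell k)"
    by (rule AE_in_cells) (auto intro: reference.PiM_component)
  ultimately have AE: "AE x in ?P. enn2real (RN_deriv ?P block x) * ln (enn2real (RN_deriv ?P block x)) = ?h x"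
  proof eventually_elim
    fix x assume eq: "ennreal (?r x) = RN_deriv ?P block x" and "x \<in> (\<Union>k\<in>indices. cell k)"
    then obtain k where k: "k \<in> indices" "x \<in> cell k" by blast
    have "enn2real (RN_deriv ?P block x) = ?r x" unfolding eq[symmetric] using r_nonneg by simp
    then show "enn2real (RN_deriv ?P block x) * ln (enn2real (RN_deriv ?P block x)) = ?h x"
      by (simp only: sum_indicator_disjoint[where A = cell, OF finite_indices disjoint_cell k])
  qed
  have ind: "integrable ?P (\<lambda>x. a * indicator (cell k) x :: real)" if "k \<in> indices" for k a
    using sets_cell[OF that] by (intro integrable_mult_right integrable_real_indicator)
      (auto simp: reference.emeasure_eq_measure)
  have int: "integrable ?P ?h" by (intro Bochner_Integration.integrable_sum ind)
  have "integral\<^sup>L ?P ?h = (\<Sum>k\<in>indices. (weight k * ln (weight k)) * measure ?P (cell k))"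
    using sets_cell ind by (subst Bochner_Integration.integral_sum) (auto intro!: sum.cong simp: sets.Int_space_eq2)
  also have "\<dots> = (\<Sum>k\<in>indices. measure \<gamma> (cell k) * ln (weight k))"
    by (intro sum.cong refl) (simp add: weight_mult[symmetric] mult_ac)
  finally have "ext_integral ?P ?h = ereal (\<Sum>k\<in>indices. measure \<gamma> (cell k) * ln (weight k))"
    using ext_integral_integrable[OF int] by simp
  moreover have "\<exists>\<rho>\<in>borel_measurable ?P. block = density ?P \<rho>"
    using r_meas block_def by blast
  ultimately show ?thesis
    unfolding rel_entropy_def using ext_integral_cong_AE[OF AE] by simp
qed

text \<open>
  The index \<open>j\<close> is free: bounding the mass of a cell under \<open>\<gamma>\<close> by that of its \<open>j\<close>-th factor removes one
  entropy from the sum.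
\<close>

lemma rel_entropy_block_le:
  "rel_entropy block (PiM UNIV \<mu>) \<le> ereal (\<Sum>i\<in>UNIV - {j}. ln (n i))"
proof -
  let ?m = "\<lambda>i l. measure (\<mu> i) (Q i l)"
  have le: "measure \<gamma> (cell k) * ln (weight k) \<le> (\<Sum>i\<in>UNIV - {j}. measure \<gamma> (cell k) * (- ln (?m i (k i))))"
    if k: "k \<in> indices" for k
  proof (cases "measure \<gamma> (cell k) = 0")
    case False
    then have w: "0 < measure \<gamma> (cell k)" by (simp add: zero_less_measure_iff)
    have m: "0 < ?m i (k i)" for i using w measure_coupling_cell_le[OF k, of i] by linarith
    have "0 < (\<Prod>i\<in>UNIV. ?m i (k i))" using m by (intro prod_pos) auto
    then have "ln (weight k) = ln (measure \<gamma> (cell k)) - (\<Sum>i\<in>UNIV. ln (?m i (k i)))"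
      unfolding weight_def measure_reference_cell[OF k]
      using w m by (simp add: ln_divide_pos ln_prod less_imp_neq[THEN not_sym] del: prod_zero_iff)
    also have "\<dots> \<le> ln (?m j (k j)) - (\<Sum>i\<in>UNIV. ln (?m i (k i)))"
      using w measure_coupling_cell_le[OF k, of j] by simp
    also have "\<dots> = (\<Sum>i\<in>UNIV - {j}. - ln (?m i (k i)))"
      by (subst sum.remove[of _ j]) (auto simp: sum_negf)
    finally have "measure \<gamma> (cell k) * ln (weight k)
        \<le> measure \<gamma> (cell k) * (\<Sum>i\<in>UNIV - {j}. - ln (?m i (k i)))"
      using w by (intro mult_left_mono) auto
    then show ?thesis by (simp add: sum_distrib_left)
  qed simp
  have "(\<Sum>k\<in>indices. measure \<gamma> (cell k) * ln (weight k))
      \<le> (\<Sum>k\<in>indices. \<Sum>i\<in>UNIV - {j}. measure \<gamma> (cell k) * (- ln (?m i (k i))))"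
    by (intro sum_mono le)
  also have "\<dots> = (\<Sum>i\<in>UNIV - {j}. \<Sum>k\<in>indices. measure \<gamma> (cell k) * (- ln (?m i (k i))))"
    by (rule sum.swap)
  also have "\<dots> = (\<Sum>i\<in>UNIV - {j}. \<Sum>l<n i. ?m i l * (- ln (?m i l)))"
    by (intro sum.cong refl sum_cells_component)
  also have "\<dots> \<le> (\<Sum>i\<in>UNIV - {j}. ln (n i))"
  proof (intro sum_mono)
    fix i
    have "(\<Sum>l<n i. ?m i l) = measure (\<mu> i) (\<Union>l<n i. Q i l)"
      using sets_cells disjoint_cells[of i]
      by (intro marginal.finite_measure_finite_Union[symmetric]) auto
    then have "(\<Sum>l<n i. ?m i l * (- ln (?m i l))) \<le> ln (card {..<n i})"
      using full_cells by (intro sum_neg_ln_le_ln_card) auto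
    then show "(\<Sum>l<n i. ?m i l * (- ln (?m i l))) \<le> ln (n i)" by simp
  qed
  finally show ?thesis unfolding rel_entropy_block by simp
qed

lemma ext_integral_block_le:
  assumes nonneg: "\<And>x. x \<in> space (PiM UNIV \<mu>) \<Longrightarrow> 0 \<le> c x"
    and osc: "\<And>k x y. k \<in> indices \<Longrightarrow> x \<in> cell k \<Longrightarrow> y \<in> cell k \<Longrightarrow> c x \<le> c y + \<eta>"
    and \<eta>: "0 \<le> \<eta>"
  shows "ext_integral block c \<le> ext_integral \<gamma> c + ereal \<eta>"
proof -
  have "(\<integral>\<^sup>+x. ennreal (c x) \<partial>block) \<le> (\<integral>\<^sup>+x. ennreal (c x) \<partial>\<gamma>) + ennreal \<eta>"
  proof (rule nn_integral_le_of_equal_cells[where I = indices and A = cell])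
    show "AE x in block. x \<in> (\<Union>k\<in>indices. cell k)"
      by (rule AE_in_cells) (auto simp: marginal_block)
    show "0 \<le> c x" if "k \<in> indices" "x \<in> cell k" for k x
      using nonneg sets.sets_into_space[OF sets_cell[OF that(1)]] that(2) by blast
    show "cell k \<in> sets \<gamma>" "cell k \<in> sets block" if "k \<in> indices" for k
      using sets_cell[OF that] by (simp_all add: sets_coupling)
    show "measure \<gamma> (cell k) = measure block (cell k)" if "k \<in> indices" for k
      using measure_block_cell[OF that] by simp
  qed (fact prob_coupling prob_space_block finite_indices disjoint_cell osc \<eta>)+
  then have "enn2ereal (\<integral>\<^sup>+x. ennreal (c x) \<partial>block) \<le> enn2ereal (\<integral>\<^sup>+x. ennreal (c x) \<partial>\<gamma>) + ereal \<eta>"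
    using \<eta> by (simp add: less_eq_ennreal.rep_eq plus_ennreal.rep_eq enn2ereal_ennreal)
  moreover have "ext_integral block c = enn2ereal (\<integral>\<^sup>+x. ennreal (c x) \<partial>block)"
    using nonneg sets_eq_imp_space_eq[OF sets_block] by (intro ext_integral_nonneg) auto
  moreover have "ext_integral \<gamma> c = enn2ereal (\<integral>\<^sup>+x. ennreal (c x) \<partial>\<gamma>)"
    using nonneg sets_eq_imp_space_eq[OF sets_coupling] by (intro ext_integral_nonneg) auto
  ultimately show ?thesis by simp
qed

text \<open>The properties of the block approximation that the upper bound needs.\<close>

lemma exists_coupling_with_cost_and_entropy_le:
  assumes nonneg: "\<And>x. x \<in> space (PiM UNIV \<mu>) \<Longrightarrow> 0 \<le> c x"
    and osc: "\<And>x y. (\<And>i. \<exists>l<n i. x i \<in> Q i l \<and> y i \<in> Q i l) \<Longrightarrow> c x \<le> c y + \<eta>"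
    and \<eta>: "0 \<le> \<eta>"
  shows "\<exists>\<kappa>. prob_space \<kappa> \<and> sets \<kappa> = sets (PiM UNIV \<mu>) \<and>
    (\<forall>i. distr \<kappa> (\<mu> i) (\<lambda>x. x i) = \<mu> i) \<and>
    ext_integral \<kappa> c \<le> ext_integral \<gamma> c + ereal \<eta> \<and>
    rel_entropy \<kappa> (PiM UNIV \<mu>) \<le> ereal (\<Sum>i\<in>UNIV - {j}. ln (n i))"
proof (intro exI[of _ block] conjI allI)
  show "ext_integral block c \<le> ext_integral \<gamma> c + ereal \<eta>"
  proof (rule ext_integral_block_le[OF nonneg _ \<eta>])
    fix k x y assume k: "k \<in> indices" and xy: "x \<in> cell k" "y \<in> cell k"
    show "c x \<le> c y + \<eta>"
    proof (rule osc)
      show "\<exists>l<n i. x i \<in> Q i l \<and> y i \<in> Q i l" for i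
        using xy index_less[OF k, of i] by (auto simp: cell_def PiE_iff)
    qed
  qed
qed (rule prob_space_block sets_block marginal_block rel_entropy_block_le)+

end

section \<open>Borel structure and supports\<close>

text \<open>
  The product of the Borel structures of the \<open>X i\<close> is that of the product; the sets \<open>X i\<close>
  need not be Borel.
\<close>

lemma sets_PiM_restrict_borel:
  fixes X :: "'i::finite \<Rightarrow> 'a::second_countable_topology set"
  assumes M: "\<And>i. sets (M i) = sets (restrict_space borel (X i))"
  shows "sets (PiM UNIV M) = sets (restrict_space borel (\<Pi>\<^sub>E i\<in>UNIV. X i))"
proof -
  have sp: "space (M i) = X i" for i
    using sets_eq_imp_space_eq[OF M[of i]] by (simp add: space_restrict_space)
  have borel: "sets (PiM UNIV (\<lambda>i::'i. borel :: 'a measure)) = sets borel"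
    by (rule sets_PiM_equal_borel)
  show ?thesis
  proof (rule subset_antisym)
    show "sets (PiM UNIV M) \<subseteq> sets (restrict_space borel (\<Pi>\<^sub>E i\<in>UNIV. X i))"
      unfolding sets_PiM_single
    proof (rule sets.sigma_sets_subset', safe)
      fix i A assume "A \<in> sets (M i)"
      then obtain B where B: "B \<in> sets borel" "A = X i \<inter> B" unfolding M sets_restrict_space by auto
      have "(\<lambda>f. f i) -` B \<inter> space (PiM UNIV (\<lambda>i::'i. borel :: 'a measure)) \<in> sets (PiM UNIV (\<lambda>i::'i. borel :: 'a measure))"
        using measurable_component_singleton[of i UNIV "\<lambda>i::'i. borel :: 'a measure"] B(1)
        by (intro measurable_sets) auto
      then have "(\<lambda>f. f i) -` B \<in> sets (borel :: ('i \<Rightarrow> 'a) measure)"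
        unfolding borel by (simp add: space_PiM PiE_UNIV_domain)
      moreover have "{f \<in> \<Pi>\<^sub>E i\<in>UNIV. space (M i). f i \<in> A} = (\<Pi>\<^sub>E i\<in>UNIV. X i) \<inter> (\<lambda>f. f i) -` B"
        by (auto simp: B(2) sp PiE_iff)
      ultimately show "{f \<in> \<Pi>\<^sub>E i\<in>UNIV. space (M i). f i \<in> A} \<in> sets (restrict_space borel (\<Pi>\<^sub>E i\<in>UNIV. X i))"
        unfolding sets_restrict_space by blast
    next
      have "(\<Pi>\<^sub>E i\<in>UNIV. X i) \<in> sets (restrict_space borel (\<Pi>\<^sub>E i\<in>UNIV. X i))"
        unfolding sets_restrict_space by (intro image_eqI[of _ _ UNIV]) auto
      then show "(\<Pi>\<^sub>E i\<in>UNIV. space (M i)) \<in> sets (restrict_space borel (\<Pi>\<^sub>E i\<in>UNIV. X i))"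
        by (simp add: sp)
    qed
    show "sets (restrict_space borel (\<Pi>\<^sub>E i\<in>UNIV. X i)) \<subseteq> sets (PiM UNIV M)"
    proof
      fix A assume "A \<in> sets (restrict_space borel (\<Pi>\<^sub>E i\<in>UNIV. X i))"
      then obtain B where B: "B \<in> sets borel" "A = (\<Pi>\<^sub>E i\<in>UNIV. X i) \<inter> B"
        unfolding sets_restrict_space by auto
      have comp: "(\<lambda>x. x i) \<in> measurable (PiM UNIV M) (borel :: 'a measure)" for i
      proof -
        have "(\<lambda>x. x i) \<in> measurable (PiM UNIV M) (restrict_space borel (X i))"
          by (simp add: measurable_cong_sets[OF refl M[of i], symmetric] measurable_component_singleton)
        then show ?thesis by (rule measurable_restrict_space2_iff[THEN iffD1, THEN conjunct1])
      qed
      have "(\<lambda>x. x) \<in> measurable (PiM UNIV M) (PiM UNIV (\<lambda>i::'i. borel :: 'a measure))"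
        using comp by (intro measurable_PiM_single') (auto simp: PiE_UNIV_domain)
      then have "(\<lambda>x. x) -` B \<inter> space (PiM UNIV M) \<in> sets (PiM UNIV M)"
        using B(1) unfolding borel[symmetric] by (rule measurable_sets)
      then show "A \<in> sets (PiM UNIV M)" by (simp add: B(2) space_PiM sp Int_commute)
    qed
  qed
qed

text \<open>Outside the support, countably many null basic open sets cover the space.\<close>

lemma AE_in_measure_support:
  fixes M :: "'a::second_countable_topology measure"
  assumes M: "sets M = sets (restrict_space borel X)"
  shows "AE x in M. x \<in> measure_support M"
proof -
  have sp: "space M = X" using sets_eq_imp_space_eq[OF M] by (simp add: space_restrict_space)
  obtain B :: "'a set set" where B: "countable B" "topological_basis B"
    using ex_countable_basis by blast
  have BM: "b \<inter> X \<in> sets M" if "b \<in> B" for b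
    using topological_basis_open[OF B(2) that] unfolding M sets_restrict_space
    by (intro image_eqI[of _ _ b]) auto
  define N where "N = (\<Union>b\<in>{b \<in> B. emeasure M (b \<inter> X) = 0}. b \<inter> X)"
  have "N \<in> null_sets M"
    unfolding N_def using B(1) BM by (intro null_sets_UN') (auto intro: null_setsI)
  moreover have "{x \<in> space M. \<not> x \<in> measure_support M} \<subseteq> N"
  proof safe
    fix x assume x: "x \<in> space M" "x \<notin> measure_support M"
    then obtain U where U: "open U" "x \<in> U" "emeasure M (U \<inter> X) = 0"
      by (auto simp: measure_support_def sp)
    obtain b where b: "b \<in> B" "x \<in> b" "b \<subseteq> U" by (rule topological_basisE[OF B(2) U(1,2)])
    have "U \<inter> X \<in> sets M"
      using U(1) unfolding M sets_restrict_space by (intro image_eqI[of _ _ U]) auto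
    then have "emeasure M (b \<inter> X) \<le> emeasure M (U \<inter> X)"
      using b(3) by (intro emeasure_mono) auto
    then show "x \<in> N" using b x(1) U(3) by (auto simp: N_def sp)
  qed
  ultimately show ?thesis by (rule AE_I')
qed

section \<open>The upper bound for the regularised problem\<close>

lemma ereal_le_INF_add:
  fixes b :: real and f :: "'a \<Rightarrow> ereal"
  assumes "\<And>x. x \<in> A \<Longrightarrow> a \<le> f x + ereal b"
  shows "a \<le> (INF x\<in>A. f x) + ereal b"
proof -
  have "a - ereal b \<le> (INF x\<in>A. f x)"
    using assms by (intro INF_greatest) (simp add: ereal_minus_le)
  then show ?thesis by (simp add: ereal_minus_le)
qed

theorem theorem3p2:
  fixes X :: "'m::finite \<Rightarrow> (real ^ 'n::finite) set"
    and d :: "'m \<Rightarrow> nat"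
    and \<mu> :: "'m \<Rightarrow> (real ^ 'n) measure"
    and c :: "('m \<Rightarrow> real ^ 'n) \<Rightarrow> real"
  assumes "CARD('m) \<ge> 2"
    and "\<And>i. lipschitz_submanifold (d i) (X i)"
    and "\<And>i. prob_space (\<mu> i)"
    and "\<And>i. sets (\<mu> i) = sets (restrict_space borel (X i))"
    and "\<And>i. compact (measure_support (\<mu> i))"
    and "\<And>x. x \<in> (\<Pi>\<^sub>E i\<in>UNIV. X i) \<Longrightarrow> 0 \<le> c x"
    and "locally_lipschitz_on (\<Pi>\<^sub>E i\<in>UNIV. X i) c"
  shows "\<exists>R. R \<in> O[at_right 0](\<lambda>\<epsilon>. \<epsilon>) \<and>
    (\<forall>\<^sub>F \<epsilon> in at_right (0::real).
       MOT_reg \<mu> c \<epsilon> \<le> MOT_zero \<mu> c +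
         ereal ((real (\<Sum>i\<in>UNIV. d i) - real (Max (range d))) * (\<epsilon> * ln (1 / \<epsilon>)) + R \<epsilon>))"
proof -
  \<comment> \<open>All points and cells are taken in the supports, where compactness makes the constants uniform.\<close>
  define K where "K i = measure_support (\<mu> i)" for i
  have sp: "space (\<mu> i) = X i" for i
    using sets_eq_imp_space_eq[OF assms(4)[of i]] by (simp add: space_restrict_space)
  have sets_P: "sets (PiM UNIV \<mu>) = sets (restrict_space borel (\<Pi>\<^sub>E i\<in>UNIV. X i))"
    using assms(4) by (rule sets_PiM_restrict_borel)
  have compact_K: "compact (K i)" for i using assms(5) by (simp add: K_def)
  have K_sub: "K i \<subseteq> X i" for i by (auto simp: K_def measure_support_def sp)
  have borel_sub: "A \<in> sets (\<mu> i)" if "A \<in> sets borel" "A \<subseteq> K i" for A i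
    using that K_sub[of i] unfolding assms(4) sets_restrict_space by (intro image_eqI[of _ _ A]) auto
  have K_full: "measure (\<mu> i) (K i) = 1" for i
  proof -
    have "K i \<in> sets (\<mu> i)"
      using compact_K[of i] by (intro borel_sub) (auto intro: borel_compact)
    then show ?thesis
      using AE_in_measure_support[OF assms(4)[of i]] prob_space.prob_eq_1[OF assms(3)[of i]]
      by (simp add: K_def)
  qed
  have K_ne: "K i \<noteq> {}" for i using K_full[of i] by auto
  have "\<exists>C\<ge>1. \<forall>\<epsilon>::real. 0 < \<epsilon> \<longrightarrow> \<epsilon> \<le> 1 \<longrightarrow>
    (\<exists>n Q. 0 < n \<and> real n \<le> C * (1 / \<epsilon>) ^ d i \<and> disjoint_family_on Q {..<n} \<and> (\<Union>k<n. Q k) = K i \<and>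
      (\<forall>k<n. Q k \<in> sets borel \<and> (\<forall>x\<in>Q k. \<forall>y\<in>Q k. dist x y \<le> 2 * \<epsilon>)))" for i
  proof -
    have "has_nets_of_order (d i) (K i)"
      using assms(2) compact_K K_sub by (rule has_nets_of_order_submanifold)
    from borel_partition_of_nets[OF this compact_imp_closed[OF compact_K] K_ne] show ?thesis
      by metis
  qed
  then obtain C where C1: "\<And>i. C i \<ge> 1" and C: "\<And>i \<epsilon>::real. 0 < \<epsilon> \<Longrightarrow> \<epsilon> \<le> 1 \<Longrightarrow>
    \<exists>n Q. 0 < n \<and> real n \<le> C i * (1 / \<epsilon>) ^ d i \<and> disjoint_family_on Q {..<n} \<and> (\<Union>k<n. Q k) = K i \<and>
      (\<forall>k<n. Q k \<in> sets borel \<and> (\<forall>x\<in>Q k. \<forall>y\<in>Q k. dist x y \<le> 2 * \<epsilon>))"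
    by metis
  have "compact (\<Pi>\<^sub>E i\<in>UNIV. K i)" using compact_K by (rule compact_PiE_UNIV)
  moreover have "(\<Pi>\<^sub>E i\<in>UNIV. K i) \<subseteq> (\<Pi>\<^sub>E i\<in>UNIV. X i)" using K_sub by (intro PiE_mono)
  ultimately obtain L \<delta> where L: "0 \<le> L" and \<delta>: "0 < \<delta>"
    and lip: "\<And>x y. x \<in> (\<Pi>\<^sub>E i\<in>UNIV. K i) \<Longrightarrow> y \<in> (\<Pi>\<^sub>E i\<in>UNIV. K i) \<Longrightarrow> max_dist x y < \<delta>
      \<Longrightarrow> \<bar>c x - c y\<bar> \<le> L * max_dist x y"
    using locally_lipschitz_on_compact[OF assms(7)] by metis
  obtain j where j: "d j = Max (range d)"
  proof -
    have "Max (range d) \<in> range d" by (intro Max_in) auto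
    then show thesis by (elim rangeE) (rule that[OF sym])
  qed
  \<comment> \<open>The constant of the remainder: \<open>2 * L\<close> bounds the cost error on cells of diameter \<open>2 * \<epsilon>\<close>
    divided by \<open>\<epsilon>\<close>, and the logarithms come from the covering constants.\<close>
  define A where "A = 2 * L + (\<Sum>i\<in>UNIV - {j}. ln (C i))"
  define D where "D = real (\<Sum>i\<in>UNIV. d i) - real (Max (range d))"
  have D: "D = (\<Sum>i\<in>UNIV - {j}. real (d i))"
    unfolding D_def j[symmetric] by (subst sum.remove[of _ j]) auto
  have bound: "MOT_reg \<mu> c \<epsilon> \<le> MOT_zero \<mu> c + ereal (D * (\<epsilon> * ln (1 / \<epsilon>)) + A * \<epsilon>)"
    if e: "0 < \<epsilon>" "\<epsilon> \<le> 1" "2 * \<epsilon> < \<delta>" for \<epsilon>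
  proof -
    obtain n Q where n: "\<And>i. 0 < n i" "\<And>i. real (n i) \<le> C i * (1 / \<epsilon>) ^ d i"
      and Q: "\<And>i. disjoint_family_on (Q i) {..<n i}" "\<And>i. (\<Union>k<n i. Q i k) = K i"
        "\<And>i k. k < n i \<Longrightarrow> Q i k \<in> sets borel"
        "\<And>i k x y. k < n i \<Longrightarrow> x \<in> Q i k \<Longrightarrow> y \<in> Q i k \<Longrightarrow> dist x y \<le> 2 * \<epsilon>"
      using C[OF e(1,2)] by metis
    have ln_n: "ln (n i) \<le> ln (C i) + d i * ln (1 / \<epsilon>)" for i
    proof -
      have "ln (n i) \<le> ln (C i * (1 / \<epsilon>) ^ d i)" using n[of i] by (intro ln_mono) auto
      also have "\<dots> = ln (C i) + d i * ln (1 / \<epsilon>)"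
        using C1[of i] e(1) by (subst ln_mult) (auto simp: ln_realpow)
      finally show ?thesis .
    qed
    have per_coupling: "MOT_reg \<mu> c \<epsilon> \<le> ext_integral \<gamma> c + ereal (D * (\<epsilon> * ln (1 / \<epsilon>)) + A * \<epsilon>)"
      if \<gamma>: "\<gamma> \<in> couplings \<mu>" for \<gamma>
    proof -
      have approx: "block_approximation \<mu> \<gamma> n Q"
      proof (rule block_approximation.intro)
        show "Q i l \<in> sets (\<mu> i)" if "l < n i" for i l
          using that Q(2)[of i] Q(3)[OF that] by (intro borel_sub) auto
        show "sets \<gamma> = sets (PiM UNIV \<mu>)" using \<gamma> unfolding sets_P by (simp add: couplings_def sp)
        show "distr \<gamma> (\<mu> i) (\<lambda>x. x i) = \<mu> i" for i using \<gamma> by (simp add: couplings_def)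
        show "prob_space \<gamma>" using \<gamma> by (simp add: couplings_def)
        show "measure (\<mu> i) (\<Union>l<n i. Q i l) = 1" for i unfolding Q(2) by (rule K_full)
      qed (rule assms(3) Q(1))+
      have "\<exists>\<kappa>. prob_space \<kappa> \<and> sets \<kappa> = sets (PiM UNIV \<mu>) \<and>
        (\<forall>i. distr \<kappa> (\<mu> i) (\<lambda>x. x i) = \<mu> i) \<and>
        ext_integral \<kappa> c \<le> ext_integral \<gamma> c + ereal (L * (2 * \<epsilon>)) \<and>
        rel_entropy \<kappa> (PiM UNIV \<mu>) \<le> ereal (\<Sum>i\<in>UNIV - {j}. ln (n i))"
      proof (rule block_approximation.exists_coupling_with_cost_and_entropy_le[OF approx])
        show "0 \<le> c x" if "x \<in> space (PiM UNIV \<mu>)" for x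
          using that assms(6) by (simp add: space_PiM sp)
        show "c x \<le> c y + L * (2 * \<epsilon>)" if xy: "\<And>i. \<exists>l<n i. x i \<in> Q i l \<and> y i \<in> Q i l" for x y
        proof -
          have dist: "dist (x i) (y i) \<le> 2 * \<epsilon>" for i using xy[of i] Q(4) by blast
          then have le: "max_dist x y \<le> 2 * \<epsilon>" by (simp add: max_dist_le_iff)
          have "x i \<in> K i \<and> y i \<in> K i" for i using xy[of i] unfolding Q(2)[of i, symmetric] by blast
          then have "\<bar>c x - c y\<bar> \<le> L * max_dist x y" using e(3) le by (intro lip) auto
          also have "\<dots> \<le> L * (2 * \<epsilon>)" using le L by (rule mult_left_mono)
          finally show ?thesis by linarith
        qed
        show "0 \<le> L * (2 * \<epsilon>)" using L e(1) by simp
      qed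
      then obtain \<kappa> where \<kappa>: "prob_space \<kappa>" "sets \<kappa> = sets (PiM UNIV \<mu>)"
          "\<And>i. distr \<kappa> (\<mu> i) (\<lambda>x. x i) = \<mu> i"
        and cost: "ext_integral \<kappa> c \<le> ext_integral \<gamma> c + ereal (L * (2 * \<epsilon>))"
        and entropy: "rel_entropy \<kappa> (PiM UNIV \<mu>) \<le> ereal (\<Sum>i\<in>UNIV - {j}. ln (n i))"
        by blast
      have "\<kappa> \<in> couplings \<mu>" using \<kappa> sets_P by (simp add: couplings_def sp)
      then have "MOT_reg \<mu> c \<epsilon> \<le> ext_integral \<kappa> c + ereal \<epsilon> * rel_entropy \<kappa> (PiM UNIV \<mu>)"
        unfolding MOT_reg_def by (rule INF_lower)
      also have "\<dots> \<le> (ext_integral \<gamma> c + ereal (L * (2 * \<epsilon>)))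
          + ereal \<epsilon> * ereal (\<Sum>i\<in>UNIV - {j}. ln (n i))"
        using e(1) by (intro add_mono ereal_mult_left_mono cost entropy) simp
      also have "\<dots> = ext_integral \<gamma> c + ereal (L * (2 * \<epsilon>) + \<epsilon> * (\<Sum>i\<in>UNIV - {j}. ln (n i)))"
        by (simp add: add.assoc)
      also have "\<dots> \<le> ext_integral \<gamma> c + ereal (D * (\<epsilon> * ln (1 / \<epsilon>)) + A * \<epsilon>)"
      proof -
        have "(\<Sum>i\<in>UNIV - {j}. ln (n i)) \<le> (\<Sum>i\<in>UNIV - {j}. ln (C i) + d i * ln (1 / \<epsilon>))"
          by (intro sum_mono ln_n)
        also have "\<dots> = (\<Sum>i\<in>UNIV - {j}. ln (C i)) + D * ln (1 / \<epsilon>)"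
          by (simp add: sum.distrib D sum_distrib_right)
        finally have "\<epsilon> * (\<Sum>i\<in>UNIV - {j}. ln (n i)) \<le> \<epsilon> * ((\<Sum>i\<in>UNIV - {j}. ln (C i)) + D * ln (1 / \<epsilon>))"
          using e(1) by (intro mult_left_mono) auto
        then have "L * (2 * \<epsilon>) + \<epsilon> * (\<Sum>i\<in>UNIV - {j}. ln (n i)) \<le> D * (\<epsilon> * ln (1 / \<epsilon>)) + A * \<epsilon>"
          by (simp add: A_def algebra_simps)
        then show ?thesis by (intro add_left_mono) simp
      qed
      finally show ?thesis .
    qed
    show ?thesis unfolding MOT_zero_def using per_coupling by (rule ereal_le_INF_add)
  qed
  show ?thesis
  proof (intro exI[of _ "\<lambda>\<epsilon>. A * \<epsilon>"] conjI)
    show "(\<lambda>\<epsilon>. A * \<epsilon>) \<in> O[at_right 0](\<lambda>\<epsilon>. \<epsilon>)" by simp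
    have "\<forall>\<^sub>F \<epsilon> in at_right (0::real). 0 < \<epsilon> \<and> \<epsilon> < min 1 (\<delta> / 2)"
      using \<delta> eventually_at_right_real[of 0 "min 1 (\<delta> / 2)"] by auto
    then show "\<forall>\<^sub>F \<epsilon> in at_right 0. MOT_reg \<mu> c \<epsilon> \<le> MOT_zero \<mu> c +
         ereal ((real (\<Sum>i\<in>UNIV. d i) - real (Max (range d))) * (\<epsilon> * ln (1 / \<epsilon>)) + A * \<epsilon>)"
      unfolding D_def[symmetric] by eventually_elim (rule bound; simp)
  qed
qed

end
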